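(* Let $F:\mathbb{Z}^2\to\mathbb{R}^3$ be a discrete isothermic minimal net with Gauss map $N$ and let $\tilde F:\mathbb{Z}^2\to\mathbb{R}^3$ be its conjugate discrete asymptotic minimal net. Consider a planar discrete curvature line of $F$, i.e. a curve $m\mapsto F_{m,n_0}$ (or $n\mapsto F_{m_0,n}$) contained in a plane. Then the normal line congruence of $F$ along this planar discrete curvature line is contained in the same plane as the curvature line if and only if the corresponding discrete asymptotic line $m\mapsto\tilde F_{m,n_0}$ (resp. $n\mapsto\tilde F_{m_0,n}$) of $\tilde F$ is a straight line.
   Context: An elementary quadrilateral $(ijkl)$ consists of the vertices $i=(m,n)$, $j=(m+1,n)$, $k=(m+1,n+1)$, $l=(m,n+1)$ of $\mathbb{Z}^2$. For a function $h$ on vertices write $dh_{ij}=h_j-h_i$, $dh_{il}=h_l-h_i$. A discrete holomorphic function is a map $g:\mathbb{Z}^2\to\mathbb{C}$ such that on every elementary quadrilateral the cross ratio satisfies $$\frac{(g_i-g_j)(g_k-g_l)}{(g_j-g_k)(g_l-g_i)}=\frac{a_{ij}}{a_{il}}\in\mathbb{R}_{<0},$$ where $a$ is a real-valued function on unoriented edges with $a_{ij}=a_{lk}$ and $a_{il}=a_{jk}$ on every elementary quadrilateral. Every discrete isothermic minimal net $F$ is given by a discrete holomorphic function $g$ through $$dF_{ij}=a_{ij}\,\mathrm{Re}\Big(\big(1-g_ig_j,\ \sqrt{-1}(1+g_ig_j),\ g_i+g_j\big)\frac{1}{dg_{ij}}\Big),$$ and the same formula with $j$ replaced by $l$. Its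 Gauss map is the inverse stereographic projection of $g$, $N=\frac{1}{1+|g|^2}(2\,\mathrm{Re}\,g,\,2\,\mathrm{Im}\,g,\,|g|^2-1)$, which takes values in $S^2$ and has edges parallel to the corresponding edges of $F$. The conjugate discrete asymptotic minimal net $\tilde F$ of $F$ is the net given by the same $g$ through $$d\tilde F_{ij}=a_{ij}\,\mathrm{Re}\Big(\big(1-g_ig_j,\ \sqrt{-1}(1+g_ig_j),\ g_i+g_j\big)\frac{\sqrt{-1}}{dg_{ij}}\Big),$$ and the same formula with $j$ replaced by $l$. It is a discrete asymptotic net: each $\tilde F_{m,n}$ and its four neighbours $\tilde F_{m\pm1,n},\tilde F_{m,n\pm1}$ lie in a common plane $\mathcal{P}_{m,n}$; its Gauss map (the unit normal of $\mathcal{P}_{m,n}$) is the same $N$. Discrete asymptotic nets are assumed non-degenerate: $\tilde F_i,\tilde F_j,\tilde F_k,\tilde F_l$ are not coplanar on any elementary quadrilateral. The normal line of $F$ at a vertex $i$ is the line through $F_i$ and $F_i+N_i$; the normal line congruence along a curve of vertices is the family of these lines. "Contained in the same plane" means that there is a plane containing all vertices of the discrete curvature line and all the normal lines at these vertices. A discrete asymptotic line is a curve $m\mapsto\tilde F_{m,n_0}$ or $n\mapsto\tilde F_{m_0,n}$; it is a straight line if all its points are collinear. *)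

theory Defs
  imports "HOL-Analysis.Analysis"
begin

type_synonym vertex = "int \<times> int"

text \<open>
  Edge labels are functions on unordered pairs of vertices, so that \<open>a {i, j}\<close> is automatically
  independent of the orientation of the edge; only the values on edges of the square lattice matter.
\<close>

definition quadrilateral :: "vertex \<Rightarrow> vertex \<Rightarrow> vertex \<Rightarrow> vertex \<Rightarrow> bool" where
  "quadrilateral i j k l \<longleftrightarrow>
     (\<exists>m n. i = (m, n) \<and> j = (m + 1, n) \<and> k = (m + 1, n + 1) \<and> l = (m, n + 1))"

definition cross_ratio :: "complex \<Rightarrow> complex \<Rightarrow> complex \<Rightarrow> complex \<Rightarrow> complex" where
  "cross_ratio z1 z2 z3 z4 = ((z1 - z2) * (z3 - z4)) / ((z2 - z3) * (z4 - z1))"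

text \<open>
  Since division by zero yields zero, negativity of the common value forces \<open>a {i, j}\<close>, \<open>a {i, l}\<close>
  and the four differences of \<open>g\<close> along the edges of a quadrilateral to be nonzero.
\<close>

definition discrete_holomorphic :: "(vertex set \<Rightarrow> real) \<Rightarrow> (vertex \<Rightarrow> complex) \<Rightarrow> bool" where
  "discrete_holomorphic a g \<longleftrightarrow>
     (\<forall>i j k l. quadrilateral i j k l \<longrightarrow>
        a {i, j} = a {l, k} \<and> a {i, l} = a {j, k} \<and>
        cross_ratio (g i) (g j) (g k) (g l) = of_real (a {i, j} / a {i, l}) \<and>
        a {i, j} / a {i, l} < 0)"

definition Re_vec :: "complex^3 \<Rightarrow> real^3" where
  "Re_vec v = (\<chi> r. Re (v $ r))"

definition weierstrass_vec :: "complex \<Rightarrow> complex \<Rightarrow> complex^3" where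
  "weierstrass_vec z w = vector [1 - z * w, \<i> * (1 + z * w), z + w]"

definition lattice_edge :: "vertex \<Rightarrow> vertex \<Rightarrow> bool" where
  "lattice_edge i j \<longleftrightarrow> (\<exists>m n. i = (m, n) \<and> (j = (m + 1, n) \<or> j = (m, n + 1)))"

text \<open>
  Discrete isothermic minimal nets and their conjugate asymptotic nets are introduced through
  their discrete Weierstrass representation, with the data \<open>a\<close> and \<open>g\<close> kept explicit because
  the Gauss map and the conjugate net are determined by them.
\<close>

definition isothermic_minimal_net ::
    "(vertex set \<Rightarrow> real) \<Rightarrow> (vertex \<Rightarrow> complex) \<Rightarrow> (vertex \<Rightarrow> real^3) \<Rightarrow> bool" where
  "isothermic_minimal_net a g F \<longleftrightarrow>
     discrete_holomorphic a g \<and>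
     (\<forall>i j. lattice_edge i j \<longrightarrow>
        F j - F i = a {i, j} *\<^sub>R Re_vec ((1 / (g j - g i)) *s weierstrass_vec (g i) (g j)))"

definition conjugate_minimal_net ::
    "(vertex set \<Rightarrow> real) \<Rightarrow> (vertex \<Rightarrow> complex) \<Rightarrow> (vertex \<Rightarrow> real^3) \<Rightarrow> bool" where
  "conjugate_minimal_net a g F' \<longleftrightarrow>
     discrete_holomorphic a g \<and>
     (\<forall>i j. lattice_edge i j \<longrightarrow>
        F' j - F' i = a {i, j} *\<^sub>R Re_vec ((\<i> / (g j - g i)) *s weierstrass_vec (g i) (g j)))"

definition nondegenerate_net :: "(vertex \<Rightarrow> real^3) \<Rightarrow> bool" where
  "nondegenerate_net F' \<longleftrightarrow>
     (\<forall>i j k l. quadrilateral i j k l \<longrightarrow> \<not> coplanar {F' i, F' j, F' k, F' l})"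

definition gauss_map :: "(vertex \<Rightarrow> complex) \<Rightarrow> vertex \<Rightarrow> real^3" where
  "gauss_map g i =
     (1 / (1 + (cmod (g i))\<^sup>2)) *\<^sub>R vector [2 * Re (g i), 2 * Im (g i), (cmod (g i))\<^sup>2 - 1]"

definition plane :: "(real^3) set \<Rightarrow> bool" where
  "plane P \<longleftrightarrow> affine P \<and> aff_dim P = 2"

definition normal_line :: "(vertex \<Rightarrow> real^3) \<Rightarrow> (vertex \<Rightarrow> real^3) \<Rightarrow> vertex \<Rightarrow> (real^3) set" where
  "normal_line F N i = affine hull {F i, F i + N i}"

definition parameter_line :: "vertex set \<Rightarrow> bool" where
  "parameter_line L \<longleftrightarrow>
     (\<exists>n0. L = range (\<lambda>m. (m, n0))) \<or> (\<exists>m0. L = range (\<lambda>n. (m0, n)))"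

end

(* With the scalar r = a_ij (1 + |g_i|^2) (1 + |g_j|^2) / (2 |dg_ij|^2), the Weierstrass
   representations become dF_ij = r dN_ij and dF'_ij = r N_i \<times> N_j.
   If a plane with normal vector d contains a curvature line together with its normal lines, then
   every N_i on it is orthogonal to d, so all dF'_ij are parallel to d. Conversely, if the edges of
   F' along the line are parallel to d, they are nonzero by non-degeneracy, so every N_i is
   orthogonal to d; then so is every dF_ij, and a plane orthogonal to d contains everything. *)

theory Submission
  imports Defs
begin

lemma gauss_map_nth:
  "gauss_map g i $ 1 = 2 * Re (g i) / (1 + (cmod (g i))\<^sup>2)"
  "gauss_map g i $ 2 = 2 * Im (g i) / (1 + (cmod (g i))\<^sup>2)"
  "gauss_map g i $ 3 = ((cmod (g i))\<^sup>2 - 1) / (1 + (cmod (g i))\<^sup>2)"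
  by (simp_all add: gauss_map_def)

text \<open>If \<open>g i = g j\<close>, both sides vanish because \<open>x / 0 = 0\<close>.\<close>

lemma weierstrass_vec_eq_gauss_map:
  fixes g :: "vertex \<Rightarrow> complex" and i j :: vertex
  defines "r \<equiv> (1 + (cmod (g i))\<^sup>2) * (1 + (cmod (g j))\<^sup>2) / (2 * (cmod (g j - g i))\<^sup>2)"
  shows "Re_vec ((1 / (g j - g i)) *s weierstrass_vec (g i) (g j))
           = r *\<^sub>R (gauss_map g j - gauss_map g i)" (is ?isothermic)
    and "Re_vec ((\<i> / (g j - g i)) *s weierstrass_vec (g i) (g j))
           = r *\<^sub>R cross3 (gauss_map g i) (gauss_map g j)" (is ?asymptotic)
proof -
  define x y u v where "x = Re (g i)" and "y = Im (g i)" and "u = Re (g j)" and "v = Im (g j)"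
  note coords = x_def [symmetric] y_def [symmetric] u_def [symmetric] v_def [symmetric]
  define A B D where "A = 1 + (x\<^sup>2 + y\<^sup>2)" and "B = 1 + (u\<^sup>2 + v\<^sup>2)"
    and "D = (u - x)\<^sup>2 + (v - y)\<^sup>2"
  have "A > 0" "B > 0"
    unfolding A_def B_def by (simp_all add: add_pos_nonneg)
  then have AB: "A \<noteq> 0" "B \<noteq> 0" by simp_all
  have norms: "1 + (cmod (g i))\<^sup>2 = A" "1 + (cmod (g j))\<^sup>2 = B" "(cmod (g j - g i))\<^sup>2 = D"
    "(cmod (g i))\<^sup>2 = A - 1" "(cmod (g j))\<^sup>2 = B - 1"
    unfolding A_def B_def D_def by (simp_all add: cmod_power2 coords)
  have quotients: "Re (1 / (g j - g i)) = (u - x) / D" "Im (1 / (g j - g i)) = (y - v) / D"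
    "Re (\<i> / (g j - g i)) = (v - y) / D" "Im (\<i> / (g j - g i)) = (u - x) / D"
    by (simp_all add: Re_divide Im_divide D_def coords)
  \<comment> \<open>Each coordinate on the left is
    \<open>Re (z * w) = Re z * Re w - Im z * Im w\<close>, where both parts of \<open>z\<close> have
    denominator \<open>D\<close>. This leaves an identity free of \<open>D\<close>; for
    \<open>D = 0\<close> both sides are 0 by the convention on division.\<close>
  have scale: "p / D * s - q / D * t = A * B / (2 * D) * c"
    if "2 * (p * s - q * t) = A * B * c" for p q s t c
    using that by (cases "D = 0") (simp_all add: field_simps)
  \<comment> \<open>\<open>A\<close> and \<open>B\<close> are the denominators of the Gauss map at
    the two endpoints. Cancelling them, in a coordinate of the difference or of the cross product,
    leaves polynomial identities in \<open>x\<close>, \<open>y\<close>, \<open>u\<close>,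
    \<open>v\<close>.\<close>
  have clear: "A * B * (p / B - q / A) = p * A - q * B"
    "A * B * (p / A * (q / B) - s / A * (t / B)) = p * q - s * t" for p q s t
    using AB by (simp_all add: field_simps)
  show ?isothermic
    by (simp add: vec_eq_iff forall_3 Re_vec_def weierstrass_vec_def gauss_map_nth r_def norms
          quotients coords del: times_divide_eq_left times_divide_eq_right)
      (intro conjI scale; unfold clear; simp add: A_def B_def algebra_simps power2_eq_square)
  show ?asymptotic
    by (simp add: vec_eq_iff forall_3 Re_vec_def weierstrass_vec_def gauss_map_nth r_def norms
          quotients coords cross3_def del: times_divide_eq_left times_divide_eq_right)
      (intro conjI scale; unfold clear; simp add: A_def B_def algebra_simps power2_eq_square)
qed

lemma isothermic_edge:
  assumes "isothermic_minimal_net a g F" "lattice_edge i j"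
  obtains r where "F j - F i = r *\<^sub>R (gauss_map g j - gauss_map g i)"
proof -
  have "F j - F i = a {i, j} *\<^sub>R Re_vec ((1 / (g j - g i)) *s weierstrass_vec (g i) (g j))"
    using assms unfolding isothermic_minimal_net_def by blast
  then show thesis
    unfolding weierstrass_vec_eq_gauss_map scaleR_scaleR by (rule that)
qed

lemma conjugate_edge:
  assumes "conjugate_minimal_net a g F'" "lattice_edge i j"
  obtains r where "F' j - F' i = r *\<^sub>R cross3 (gauss_map g i) (gauss_map g j)"
proof -
  have "F' j - F' i = a {i, j} *\<^sub>R Re_vec ((\<i> / (g j - g i)) *s weierstrass_vec (g i) (g j))"
    using assms unfolding conjugate_minimal_net_def by blast
  then show thesis
    unfolding weierstrass_vec_eq_gauss_map scaleR_scaleR by (rule that)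
qed

text \<open>The quadrilateral with lower left corner \<open>i\<close> also has \<open>j\<close> as a
  vertex. If the two images agreed, its four image points would be at most three, hence
  coplanar.\<close>

lemma nondegenerate_edge:
  assumes "nondegenerate_net F'" "lattice_edge i j"
  shows "F' i \<noteq> F' j"
proof
  assume eq: "F' i = F' j"
  obtain m n where "i = (m, n)" and j: "j = (m + 1, n) \<or> j = (m, n + 1)"
    using assms(2) by (auto simp: lattice_edge_def)
  then have "quadrilateral i (m + 1, n) (m + 1, n + 1) (m, n + 1)"
    by (simp add: quadrilateral_def)
  then have "\<not> coplanar {F' i, F' (m + 1, n), F' (m + 1, n + 1), F' (m, n + 1)}"
    using assms(1) unfolding nondegenerate_net_def by blast
  with eq j show False
    by (auto simp: insert_commute coplanar_3)
qed

text \<open>Allows both families of parameter lines to be treated at once, walking along consecutive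
  edges.\<close>

lemma parameter_line_cases:
  assumes "parameter_line L"
  obtains p :: "int \<Rightarrow> vertex" where "L = range p" "\<And>m. lattice_edge (p m) (p (m + 1))"
  using assms that unfolding parameter_line_def lattice_edge_def by blast

lemma int_step_const:
  fixes f :: "int \<Rightarrow> 'a"
  assumes "\<And>m. f (m + 1) = f m"
  shows "f m = f n"
proof (induction m rule: int_induct [where k = n])
  case (step2 i)
  then show ?case using assms [of "i - 1"] by simp
qed (simp_all add: assms)

text \<open>Equal cross products with \<open>d\<close> mean that the difference is parallel to
  \<open>d\<close>. Collinearity thus becomes constancy of a function, which can be checked edge by
  edge with \<open>int_step_const\<close>.\<close>

lemma collinear_if_cross3_const:
  fixes S :: "(real^3) set"
  assumes "d \<noteq> 0" and "\<And>x y. x \<in> S \<Longrightarrow> y \<in> S \<Longrightarrow> cross3 d x = cross3 d y"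
  shows "collinear S"
  unfolding collinear_def
proof (rule exI, intro ballI)
  fix x y assume "x \<in> S" "y \<in> S"
  then have "cross3 d (x - y) = 0"
    using assms(2) [of x y] by (simp add: Cross3.right_diff_distrib)
  \<comment> \<open>A vector parallel to the nonzero \<open>d\<close> is a multiple of it; the
    witness 0 covers \<open>x = y\<close>.\<close>
  then show "\<exists>c. x - y = c *\<^sub>R d"
    using \<open>d \<noteq> 0\<close> by (auto simp: cross_eq_0 collinear_lemma intro: exI [of _ 0])
qed

lemma plane_eq_hyperplane:
  assumes "plane P"
  obtains d b where "d \<noteq> 0" "P = {x. d \<bullet> x = b}"
  using assms aff_dim_eq_hyperplane [of P] by (auto simp: plane_def hull_same)

lemma plane_hyperplane: "d \<noteq> 0 \<Longrightarrow> plane {x. d \<bullet> x = b}"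
  by (simp add: plane_def affine_hyperplane)

theorem corollary3p10:
  fixes a :: "vertex set \<Rightarrow> real"
    and g :: "vertex \<Rightarrow> complex"
    and F F' :: "vertex \<Rightarrow> real^3"
    and L :: "vertex set"
  assumes "isothermic_minimal_net a g F"
    and "conjugate_minimal_net a g F'"
    and "nondegenerate_net F'"
    and "parameter_line L"
    and "\<exists>P. plane P \<and> F ` L \<subseteq> P"
  shows "(\<exists>P. plane P \<and> F ` L \<subseteq> P \<and> (\<forall>i\<in>L. normal_line F (gauss_map g) i \<subseteq> P))
         \<longleftrightarrow> collinear (F' ` L)"
proof -
  let ?N = "gauss_map g"
  obtain p :: "int \<Rightarrow> vertex" where L: "L = range p"
    and edge: "\<And>m. lattice_edge (p m) (p (m + 1))"
    using parameter_line_cases [OF assms(4)] by metis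
  show ?thesis
  proof
    assume "\<exists>P. plane P \<and> F ` L \<subseteq> P \<and> (\<forall>i\<in>L. normal_line F ?N i \<subseteq> P)"
    then obtain P where "plane P" and P: "\<And>i. i \<in> L \<Longrightarrow> normal_line F ?N i \<subseteq> P"
      by blast
    then obtain d b where "d \<noteq> 0" and P_eq: "P = {x. d \<bullet> x = b}"
      using plane_eq_hyperplane by metis
    have orth: "d \<bullet> ?N (p m) = 0" for m
    proof -
      have "{F (p m), F (p m) + ?N (p m)} \<subseteq> P"
        using P [of "p m"] hull_subset [of "{F (p m), F (p m) + ?N (p m)}" affine]
        by (auto simp: L normal_line_def)
      then show ?thesis by (auto simp: P_eq inner_add_right)
    qed
    have "cross3 d (F' (p (m + 1))) = cross3 d (F' (p m))" for m
    proof -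
      obtain r where "F' (p (m + 1)) - F' (p m) = r *\<^sub>R cross3 (?N (p m)) (?N (p (m + 1)))"
        using conjugate_edge [OF assms(2) edge] .
      \<comment> \<open>Lagrange's formula expands the double cross product into a combination of
        the two normals whose coefficients are their inner products with \<open>d\<close>, both zero
        by \<open>orth\<close>.\<close>
      then have "cross3 d (F' (p (m + 1)) - F' (p m)) = 0"
        by (simp add: cross_mult_right Lagrange orth)
      then show ?thesis by (simp add: Cross3.right_diff_distrib)
    qed
    then have "cross3 d (F' (p m)) = cross3 d (F' (p n))" for m n
      by (rule int_step_const)
    then show "collinear (F' ` L)"
      by (intro collinear_if_cross3_const [OF \<open>d \<noteq> 0\<close>]) (auto simp: L)
  next
    assume "collinear (F' ` L)"
    then obtain d where d: "\<And>m n. \<exists>c. F' (p m) - F' (p n) = c *\<^sub>R d"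
      unfolding collinear_def L by blast
    have nz: "F' (p (m + 1)) \<noteq> F' (p m)" for m
      using nondegenerate_edge [OF assms(3) edge] by metis
    have "d \<noteq> 0"
      using d [of 1 0] nz [of 0] by auto
    have orth: "d \<bullet> ?N (p m) = 0" for m
    proof -
      obtain c where c: "F' (p (m + 1)) - F' (p m) = c *\<^sub>R d"
        using d by blast
      obtain r where "F' (p (m + 1)) - F' (p m) = r *\<^sub>R cross3 (?N (p m)) (?N (p (m + 1)))"
        using conjugate_edge [OF assms(2) edge] .
      \<comment> \<open>A cross product is orthogonal to its first factor. Considering only the
        initial vertex of each edge suffices, since every \<open>p m\<close> starts one.\<close>
      then have "(c *\<^sub>R d) \<bullet> ?N (p m) = 0"
        by (simp add: c dot_cross_self)
      moreover have "c \<noteq> 0" using c nz [of m] by auto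
      ultimately show ?thesis by simp
    qed
    have "d \<bullet> F (p (m + 1)) = d \<bullet> F (p m)" for m
    proof -
      obtain r where "F (p (m + 1)) - F (p m) = r *\<^sub>R (?N (p (m + 1)) - ?N (p m))"
        using isothermic_edge [OF assms(1) edge] .
      then have "d \<bullet> (F (p (m + 1)) - F (p m)) = 0"
        by (simp add: inner_diff_right orth)
      then show ?thesis by (simp add: inner_diff_right)
    qed
    then have const: "d \<bullet> F (p m) = d \<bullet> F (p 0)" for m
      by (rule int_step_const)
    \<comment> \<open>The plane through \<open>F (p 0)\<close> orthogonal to the asymptotic line. By
      \<open>const\<close> and \<open>orth\<close> it contains both points spanning each normal
      line, hence the whole line.\<close>
    let ?P = "{x. d \<bullet> x = d \<bullet> F (p 0)}"
    have "F (p m) \<in> ?P" for m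
      using const [of m] by simp
    moreover have "normal_line F ?N (p m) \<subseteq> ?P" for m
      unfolding normal_line_def using const [of m]
      by (intro hull_minimal) (simp_all add: affine_hyperplane inner_add_right orth)
    ultimately show "\<exists>P. plane P \<and> F ` L \<subseteq> P \<and> (\<forall>i\<in>L. normal_line F ?N i \<subseteq> P)"
      using plane_hyperplane [OF \<open>d \<noteq> 0\<close>]
      unfolding L by blast
  qed
qed

end
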